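(* Let $C_n=[0,1]^n\subset\mathbb{R}^n$ be the $n$-cube. The hyperplane $\sum_i x_i=1$ cuts $C_n$ into two polytopes, the simplex $\Delta_n=\{x\in C_n : \sum_i x_i\le 1\}$ and its complement $C_n-\Delta_n$, understood as the closed polytope $\{x\in C_n:\sum_i x_i\ge 1\}$. Let $\nabla_n$ denote the graph multiplihedron $\mathcal{J}G$ of the graph $G$ consisting of $n$ disjoint nodes (no edges). Then $\nabla_n$ is combinatorially equivalent to the Minkowski sum $\Delta_n\oplus(C_n-\Delta_n)$.
   Context: The Minkowski sum of $A,B\subset\mathbb{R}^n$ is $A\oplus B=\{x+y : x\in A,\ y\in B\}$. Graphs are finite, simple, with at least one node. A tube of $G$ is a nonempty set of nodes whose induced subgraph is connected; in addition, the set of all nodes of $G$ (whether or not $G$ is connected) is considered a tube, called the universal tube. Two distinct tubes $u_1,u_2$ intersect if $u_1\cap u_2\ne\emptyset$, $u_1\not\subset u_2$ and $u_2\not\subset u_1$; they are adjacent if $u_1\cap u_2=\emptyset$ and $u_1\cup u_2$ is a tube; they are compatible if they neither intersect nor are adjacent. A tubing of $G$ is a set of pairwise compatible tubes of $G$ that contains the universal tube and, if $G$ is disconnected, does not contain all of the tubes given by the node sets of the connected components of $G$. A marked tubing of $G$ is a tubing together with an assignment to each of its tubes of exactly one of the markings thin, thick, broken, such that whenever $u\subsetneq v$ are tubes of the tubing and $v$ is not thick, then $u$ is thin. In a tubing, $u$ is closely nested in $v$, written $u\Subset v$, if $u\subsetneq v$ and no tube $u'$ of the tubing satisfies $u\subsetneq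 u'\subsetneq v$. Order on marked tubings: $U\preceq U'$ if $U$ is obtained from $U'$ by a finite (possibly empty) sequence of the following moves, each producing again a marked tubing: (1) a broken tube becomes thin or becomes thick; (2) a thin tube is added inside a thin tube or inside a broken tube; (3) a thick tube is added inside a thick tube; (4) a nonempty collection of compatible broken tubes $\{u_1,\dots,u_m\}$ is added simultaneously inside a broken tube $v$, with $u_i\Subset v$ for all $i$ in the resulting tubing, and at the same time $v$ becomes thick. The graph multiplihedron $\mathcal{J}G$ of a graph $G$ with $n$ nodes is the $n$-dimensional convex polytope (unique up to combinatorial equivalence) whose face poset (nonempty faces, including the polytope itself, ordered by inclusion) is isomorphic to the poset of marked tubings of $G$ under $\preceq$. Two polytopes are combinatorially equivalent if their face posets are isomorphic. *)

theory Defs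
  imports "HOL-Analysis.Analysis"
begin

section \<open>Graphs, tubes and tubings\<close>

text \<open>A graph is given by its node set \<open>V\<close> and its edge relation \<open>E\<close>, an edge being
  represented by both of its orientations.\<close>

definition simple_graph :: "'v set \<Rightarrow> ('v \<times> 'v) set \<Rightarrow> bool" where
  "simple_graph V E \<longleftrightarrow>
     finite V \<and> V \<noteq> {} \<and> E \<subseteq> V \<times> V \<and> sym E \<and> irrefl E"

definition induced_connected :: "('v \<times> 'v) set \<Rightarrow> 'v set \<Rightarrow> bool" where
  "induced_connected E S \<longleftrightarrow>
     S \<noteq> {} \<and> (\<forall>x\<in>S. \<forall>y\<in>S. (x, y) \<in> (E \<inter> S \<times> S)\<^sup>*)"

definition graph_components :: "'v set \<Rightarrow> ('v \<times> 'v) set \<Rightarrow> 'v set set" where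
  "graph_components V E = {{y \<in> V. (x, y) \<in> (E \<inter> V \<times> V)\<^sup>*} | x. x \<in> V}"

definition tube :: "'v set \<Rightarrow> ('v \<times> 'v) set \<Rightarrow> 'v set \<Rightarrow> bool" where
  "tube V E u \<longleftrightarrow> (u \<subseteq> V \<and> induced_connected E u) \<or> u = V"

definition tubes_intersect :: "'v set \<Rightarrow> 'v set \<Rightarrow> bool" where
  "tubes_intersect u v \<longleftrightarrow> u \<inter> v \<noteq> {} \<and> \<not> u \<subseteq> v \<and> \<not> v \<subseteq> u"

definition tubes_adjacent :: "'v set \<Rightarrow> ('v \<times> 'v) set \<Rightarrow> 'v set \<Rightarrow> 'v set \<Rightarrow> bool" where
  "tubes_adjacent V E u v \<longleftrightarrow> u \<inter> v = {} \<and> tube V E (u \<union> v)"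

definition compatible :: "'v set \<Rightarrow> ('v \<times> 'v) set \<Rightarrow> 'v set \<Rightarrow> 'v set \<Rightarrow> bool" where
  "compatible V E u v \<longleftrightarrow> \<not> tubes_intersect u v \<and> \<not> tubes_adjacent V E u v"

definition tubing :: "'v set \<Rightarrow> ('v \<times> 'v) set \<Rightarrow> 'v set set \<Rightarrow> bool" where
  "tubing V E T \<longleftrightarrow>
     (\<forall>u\<in>T. tube V E u) \<and> pairwise (compatible V E) T \<and> V \<in> T \<and>
     (\<not> induced_connected E V \<longrightarrow> \<not> graph_components V E \<subseteq> T)"

definition closely_nested :: "'v set set \<Rightarrow> 'v set \<Rightarrow> 'v set \<Rightarrow> bool" where
  "closely_nested T u v \<longleftrightarrow>
     u \<in> T \<and> v \<in> T \<and> u \<subset> v \<and> \<not> (\<exists>w\<in>T. u \<subset> w \<and> w \<subset> v)"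


section \<open>Marked tubings\<close>

datatype marking = Thin | Thick | Broken

text \<open>A marked tubing is encoded as a single partial map \<open>M\<close>: the underlying tubing is
  \<open>dom M\<close>, and \<open>M u = Some m\<close> says that \<open>u\<close> is a tube of it carrying the marking \<open>m\<close>.\<close>

definition marked_tubing ::
    "'v set \<Rightarrow> ('v \<times> 'v) set \<Rightarrow> ('v set \<rightharpoonup> marking) \<Rightarrow> bool" where
  "marked_tubing V E M \<longleftrightarrow>
     tubing V E (dom M) \<and>
     (\<forall>u\<in>dom M. \<forall>v\<in>dom M. u \<subset> v \<and> M v \<noteq> Some Thick \<longrightarrow> M u = Some Thin)"

text \<open>\<open>marking_move V E M N\<close>: the marked tubing \<open>N\<close> is the result of one move applied to \<open>M\<close>.\<close>

inductive marking_move ::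
    "'v set \<Rightarrow> ('v \<times> 'v) set \<Rightarrow> ('v set \<rightharpoonup> marking) \<Rightarrow> ('v set \<rightharpoonup> marking) \<Rightarrow> bool"
  for V :: "'v set" and E :: "('v \<times> 'v) set" where
  resolve_broken:
    "\<lbrakk>M u = Some Broken; m = Thin \<or> m = Thick; N = M(u \<mapsto> m); marked_tubing V E N\<rbrakk>
      \<Longrightarrow> marking_move V E M N"
| add_thin:
    "\<lbrakk>u \<notin> dom M; u \<subset> v; M v = Some Thin \<or> M v = Some Broken;
      N = M(u \<mapsto> Thin); marked_tubing V E N\<rbrakk>
      \<Longrightarrow> marking_move V E M N"
| add_thick:
    "\<lbrakk>u \<notin> dom M; u \<subset> v; M v = Some Thick; N = M(u \<mapsto> Thick); marked_tubing V E N\<rbrakk>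
      \<Longrightarrow> marking_move V E M N"
| add_broken:
    "\<lbrakk>B \<noteq> {}; B \<inter> dom M = {}; M v = Some Broken;
      N = (\<lambda>w. if w \<in> B then Some Broken else if w = v then Some Thick else M w);
      \<forall>u\<in>B. closely_nested (dom N) u v; marked_tubing V E N\<rbrakk>
      \<Longrightarrow> marking_move V E M N"

text \<open>\<open>marking_le V E M N\<close> is the order relation \<open>M \<preceq> N\<close>; moves go downwards.\<close>

definition marking_le ::
    "'v set \<Rightarrow> ('v \<times> 'v) set \<Rightarrow> ('v set \<rightharpoonup> marking) \<Rightarrow> ('v set \<rightharpoonup> marking) \<Rightarrow> bool" where
  "marking_le V E M N \<longleftrightarrow> (marking_move V E)\<^sup>*\<^sup>* N M"


section \<open>Face posets and graph multiplihedra\<close>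

definition posets_isomorphic ::
    "'a set \<Rightarrow> ('a \<Rightarrow> 'a \<Rightarrow> bool) \<Rightarrow> 'b set \<Rightarrow> ('b \<Rightarrow> 'b \<Rightarrow> bool) \<Rightarrow> bool" where
  "posets_isomorphic A le B le' \<longleftrightarrow>
     (\<exists>f. bij_betw f A B \<and> (\<forall>x\<in>A. \<forall>y\<in>A. le x y \<longleftrightarrow> le' (f x) (f y)))"

definition nonempty_faces :: "'a::euclidean_space set \<Rightarrow> 'a set set" where
  "nonempty_faces P = {F. F face_of P \<and> F \<noteq> {}}"

definition combinatorially_equivalent ::
    "'a::euclidean_space set \<Rightarrow> 'b::euclidean_space set \<Rightarrow> bool" where
  "combinatorially_equivalent P Q \<longleftrightarrow>
     polytope P \<and> polytope Q \<and>
     posets_isomorphic (nonempty_faces P) (\<subseteq>) (nonempty_faces Q) (\<subseteq>)"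

text \<open>The graph multiplihedron is only determined up to combinatorial equivalence, so it is
  rendered as a predicate on sets in an arbitrary Euclidean space.\<close>

definition graph_multiplihedron ::
    "'v set \<Rightarrow> ('v \<times> 'v) set \<Rightarrow> 'a::euclidean_space set \<Rightarrow> bool" where
  "graph_multiplihedron V E P \<longleftrightarrow>
     simple_graph V E \<and> polytope P \<and> aff_dim P = int (card V) \<and>
     posets_isomorphic (nonempty_faces P) (\<subseteq>)
       {M. marked_tubing V E M} (marking_le V E)"


section \<open>The two pieces of the cube\<close>

definition unit_cube :: "(real ^ 'n) set" where
  "unit_cube = {x. \<forall>i. 0 \<le> x $ i \<and> x $ i \<le> 1}"

definition cube_simplex :: "(real ^ 'n) set" where
  "cube_simplex = {x \<in> unit_cube. (\<Sum>i\<in>UNIV. x $ i) \<le> 1}"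

definition cube_minus_simplex :: "(real ^ 'n) set" where
  "cube_minus_simplex = {x \<in> unit_cube. (\<Sum>i\<in>UNIV. x $ i) \<ge> 1}"

lemma polytope_unit_cube: "polytope (unit_cube :: (real ^ 'n) set)"
proof -
  have "unit_cube = (cbox 0 1 :: (real ^ 'n) set)"
    by (auto simp: unit_cube_def mem_box_cart)
  then show ?thesis by (metis polytope_interval)
qed

lemma polytope_cube_simplex: "polytope (cube_simplex :: (real ^ 'n) set)"
proof -
  have "cube_simplex = (unit_cube \<inter> {x. 1 \<bullet> x \<le> 1} :: (real ^ 'n) set)"
    by (auto simp: cube_simplex_def inner_vec_def)
  then show ?thesis
    by (metis polytope_Int_polyhedron polytope_unit_cube polyhedron_halfspace_le)
qed

lemma polytope_cube_minus_simplex: "polytope (cube_minus_simplex :: (real ^ 'n) set)"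
proof -
  have "cube_minus_simplex = (unit_cube \<inter> {x. 1 \<bullet> x \<ge> 1} :: (real ^ 'n) set)"
    by (auto simp: cube_minus_simplex_def inner_vec_def)
  then show ?thesis
    by (metis polytope_Int_polyhedron polytope_unit_cube polyhedron_halfspace_ge)
qed

end

theory Submission
  imports Defs
begin

text \<open>The Minkowski sum consists of the \<open>x \<ge> 0\<close> with \<open>\<Sum>i. x $ i \<ge> 1\<close> and
  \<open>\<Sum>i. max 0 (x $ i - 1) \<le> 1\<close>; the last inequality bundles the facet inequalities
  \<open>\<Sum>i\<in>A. x $ i \<le> card A + 1\<close>.  A point of it determines a marked tubing: the universal tube
  is thin if the first sum is \<open>1\<close>, thick if the second one is \<open>1\<close>, and broken otherwise; a node
  \<open>i\<close> is a thin tube if \<open>x $ i = 0\<close>, and below a thick universal tube it is broken, thick or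
  absent according to whether \<open>x $ i < 1\<close>, \<open>x $ i = 1\<close> or \<open>x $ i > 1\<close>.  The points sharing
  a marked tubing are those for which the same inequalities are tight, i.e. they form the relative
  interior of a face, and the order generated by the moves turns out to be inclusion of faces.\<close>

section \<open>Marked tubings of an edgeless graph\<close>

lemma induced_connected_edgeless: "induced_connected {} S \<longleftrightarrow> (\<exists>v. S = {v})"
proof
  assume "induced_connected {} S"
  then have "S \<noteq> {}" "\<forall>x\<in>S. \<forall>y\<in>S. x = y" by (simp_all add: induced_connected_def)
  then show "\<exists>v. S = {v}" by blast
qed (auto simp: induced_connected_def)

lemma graph_components_edgeless: "graph_components V {} = (\<lambda>v. {v}) ` V"
  by (auto simp: graph_components_def)

lemma tube_edgeless: "tube V {} u \<longleftrightarrow> u = V \<or> (\<exists>v\<in>V. u = {v})"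
  by (auto simp: tube_def induced_connected_edgeless)

text \<open>Without edges compatibility is nearly automatic: singletons are disjoint and lie inside
  \<open>V\<close>. Two of them can be adjacent only if their union is \<open>V\<close>, and then
  every component is in \<open>T\<close>, which is excluded anyway. The alternative
  \<open>V = {v}\<close> covers the connected case of a single node.\<close>

lemma tubing_edgeless:
  "tubing V {} T \<longleftrightarrow>
    V \<in> T \<and> T \<subseteq> insert V ((\<lambda>v. {v}) ` V) \<and> (\<exists>v\<in>V. V = {v} \<or> {v} \<notin> T)"
  (is "_ \<longleftrightarrow> ?R")
proof
  assume T: "tubing V {} T"
  then have "V \<noteq> {}"
    by (auto simp: tubing_def graph_components_edgeless induced_connected_edgeless)
  with T show ?R
    by (auto simp: tubing_def graph_components_edgeless induced_connected_edgeless tube_edgeless)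
next
  assume R: ?R
  then obtain v where v: "v \<in> V" "V = {v} \<or> {v} \<notin> T" by auto
  have "compatible V {} a b" if ab: "a \<in> T" "b \<in> T" "a \<noteq> b" for a b
  proof -
    have "a \<in> insert V ((\<lambda>v. {v}) ` V)" "b \<in> insert V ((\<lambda>v. {v}) ` V)" using ab R by auto
    moreover have "\<not> (a \<union> b = V \<and> a \<noteq> V \<and> b \<noteq> V)"
      using v ab calculation by auto
    ultimately show ?thesis using v ab
      by (auto simp: compatible_def tubes_intersect_def tubes_adjacent_def tube_edgeless)
  qed
  moreover have "\<not> graph_components V {} \<subseteq> T" if "\<not> induced_connected {} V"
    using v that by (auto simp: graph_components_edgeless induced_connected_edgeless)
  moreover have "\<forall>u\<in>T. tube V {} u" using R by (auto simp: tube_edgeless)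
  ultimately show "tubing V {} T"
    using R by (simp add: tubing_def pairwise_def)
qed

text \<open>The only strict inclusions are those of singletons in \<open>V\<close>, so the nesting
  condition on markings constrains the nodes only through the marking of \<open>V\<close>.\<close>

lemma marked_tubing_edgeless:
  "marked_tubing V {} M \<longleftrightarrow>
    V \<in> dom M \<and> dom M \<subseteq> insert V ((\<lambda>v. {v}) ` V) \<and>
    (\<exists>v\<in>V. V = {v} \<or> {v} \<notin> dom M) \<and>
    (M V \<noteq> Some Thick \<longrightarrow> (\<forall>u. u \<noteq> V \<longrightarrow> M u = None \<or> M u = Some Thin))"
  (is "_ \<longleftrightarrow> ?V \<and> ?sub \<and> ?proper \<and> ?mark")
proof -
  have "(\<forall>u\<in>dom M. \<forall>v\<in>dom M. u \<subset> v \<and> M v \<noteq> Some Thick \<longrightarrow> M u = Some Thin) \<longleftrightarrow> ?mark"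
    (is "?nested \<longleftrightarrow> _") if V: ?V and sub: ?sub
  proof
    assume nested: ?nested
    show ?mark
    proof (intro impI allI)
      fix u assume u: "M V \<noteq> Some Thick" "u \<noteq> V"
      show "M u = None \<or> M u = Some Thin"
      proof (cases "u \<in> dom M")
        case True
        with u sub obtain v where "v \<in> V" "u = {v}" by blast
        with u have "u \<subset> V" by auto
        with nested True V u show ?thesis by metis
      qed (simp add: domIff)
    qed
  next
    assume mark: ?mark
    show ?nested
    proof (intro ballI impI)
      fix u v assume uv: "u \<in> dom M" "v \<in> dom M" "u \<subset> v \<and> M v \<noteq> Some Thick"
      have "v = V"
      proof (rule ccontr)
        assume "v \<noteq> V"
        with uv(2) sub obtain y where "v = {y}" by blast
        with uv(3) have "u = {}" by blast
        moreover from \<open>v = {y}\<close> \<open>v \<noteq> V\<close> uv(2) sub have "V \<noteq> {}" by blast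
        ultimately show False using uv(1) sub by blast
      qed
      moreover have "u \<noteq> v" using uv(3) by blast
      ultimately have "M u = None \<or> M u = Some Thin" using mark uv(3) by metis
      with uv(1) show "M u = Some Thin" by auto
    qed
  qed
  then have "(?V \<and> ?sub \<and> ?proper) \<and> ?nested \<longleftrightarrow> (?V \<and> ?sub \<and> ?proper) \<and> ?mark"
    by (intro conj_cong refl) (elim conjE)
  then show ?thesis
    unfolding marked_tubing_def tubing_edgeless by (simp only: conj_assoc)
qed

lemma
  assumes "marked_tubing V {} M"
  shows marked_tubing_edgeless_universal: "V \<in> dom M"
    and marked_tubing_edgeless_tube: "u \<in> dom M \<Longrightarrow> u \<noteq> V \<Longrightarrow> \<exists>v\<in>V. u = {v}"
    and marked_tubing_edgeless_thin:
      "M V \<noteq> Some Thick \<Longrightarrow> u \<noteq> V \<Longrightarrow> M u = None \<or> M u = Some Thin"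
proof -
  note * = assms[unfolded marked_tubing_edgeless]
  show "V \<in> dom M" by (rule *[THEN conjunct1])
  show "u \<in> dom M \<Longrightarrow> u \<noteq> V \<Longrightarrow> \<exists>v\<in>V. u = {v}"
    using *[THEN conjunct2, THEN conjunct1] by blast
  show "M V \<noteq> Some Thick \<Longrightarrow> u \<noteq> V \<Longrightarrow> M u = None \<or> M u = Some Thin"
    using *[THEN conjunct2, THEN conjunct2, THEN conjunct2] by metis
qed

text \<open>Forces the outer tube of each of the three adding moves to be \<open>V\<close>.\<close>

lemma marked_tubing_edgeless_psubset:
  assumes M: "marked_tubing V {} M" and u: "u \<in> dom M" and v: "v \<in> dom M" and "u \<subset> v"
  shows "v = V"
proof (rule ccontr)
  assume "v \<noteq> V"
  then obtain y where y: "y \<in> V" "v = {y}" using marked_tubing_edgeless_tube[OF M v] by blast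
  with \<open>u \<subset> v\<close> have "u = {}" by blast
  then show False
    using marked_tubing_edgeless_tube[OF M u] y(1) by blast
qed

text \<open>With the universal tube thick, the states of a node stand for ranges of its coordinate:
  0 (thin), strictly between 0 and 1 (broken), 1 (thick), above 1 (no tube). Then \<open>a\<close>
  is below \<open>b\<close> iff the range of \<open>a\<close> lies in the closure of the range of
  \<open>b\<close>.\<close>

definition node_below :: "marking option \<Rightarrow> marking option \<Rightarrow> bool" where
  "node_below a b \<longleftrightarrow> a = b \<or>
     b = Some Broken \<and> (a = Some Thin \<or> a = Some Thick) \<or> b = None \<and> a = Some Thick"

text \<open>If \<open>N V\<close> is not thick, all nodes that are tubes of a marked tubing
  \<open>N\<close> are thin, and these persist under moves. Nothing is asked of the other nodes: a
  broken \<open>V\<close> may still become thick and then every state is reachable, while for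
  \<open>M V\<close> not thick the marking condition on \<open>M\<close> already restricts
  them.\<close>

definition marking_below ::
    "'v set \<Rightarrow> ('v set \<rightharpoonup> marking) \<Rightarrow> ('v set \<rightharpoonup> marking) \<Rightarrow> bool" where
  "marking_below V M N \<longleftrightarrow> (M V = N V \<or> N V = Some Broken) \<and>
     (\<forall>u. u \<noteq> V \<longrightarrow> (if N V = Some Thick then node_below (M u) (N u)
                       else N u = Some Thin \<longrightarrow> M u = Some Thin))"

lemma
  assumes "marking_below V M N"
  shows marking_below_universal: "M V = N V \<or> N V = Some Broken"
    and marking_below_thick: "N V = Some Thick \<Longrightarrow> u \<noteq> V \<Longrightarrow> node_below (M u) (N u)"
    and marking_below_thin:
      "N V \<noteq> Some Thick \<Longrightarrow> u \<noteq> V \<Longrightarrow> N u = Some Thin \<Longrightarrow> M u = Some Thin"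
  using assms unfolding marking_below_def by metis+

lemma marking_belowI:
  assumes "M V = N V \<or> N V = Some Broken"
    and "\<And>u. u \<noteq> V \<Longrightarrow> N V = Some Thick \<Longrightarrow> node_below (M u) (N u)"
    and "\<And>u. u \<noteq> V \<Longrightarrow> N V \<noteq> Some Thick \<Longrightarrow> N u = Some Thin \<Longrightarrow> M u = Some Thin"
  shows "marking_below V M N"
  using assms unfolding marking_below_def by simp

lemma node_below_trans: "node_below a b \<Longrightarrow> node_below b c \<Longrightarrow> node_below a c"
  by (auto simp: node_below_def)

lemma node_below_antisym: "node_below a b \<Longrightarrow> node_below b a \<Longrightarrow> a = b"
  by (auto simp: node_below_def)

lemma node_below_Thin: "node_below a (Some Thin) \<longleftrightarrow> a = Some Thin"
  by (auto simp: node_below_def)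

lemma marking_below_refl: "marking_below V M M"
  by (rule marking_belowI) (simp_all add: node_below_def)

lemma marking_below_trans:
  assumes LM: "marking_below V L M" and MN: "marking_below V M N"
  shows "marking_below V L N"
proof (rule marking_belowI)
  show univ: "L V = N V \<or> N V = Some Broken"
    using marking_below_universal[OF LM] marking_below_universal[OF MN] by auto
  fix u assume u: "u \<noteq> V"
  show "node_below (L u) (N u)" if N: "N V = Some Thick"
  proof -
    have "M V = Some Thick" using marking_below_universal[OF MN] N by simp
    then show ?thesis
      using node_below_trans marking_below_thick[OF LM _ u] marking_below_thick[OF MN N u] by blast
  qed
  show "L u = Some Thin" if N: "N V \<noteq> Some Thick" "N u = Some Thin"
  proof -
    \<comment> \<open>\<open>M V\<close> may be thick although \<open>N V\<close> is not. Thin is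
      minimal for \<open>node_below\<close>, so the thin node survives in \<open>L\<close> whichever
      clause compares \<open>L\<close> with \<open>M\<close>.\<close>
    have "M u = Some Thin" by (rule marking_below_thin[OF MN N(1) u N(2)])
    then show ?thesis
      using marking_below_thick[OF LM _ u] marking_below_thin[OF LM _ u] node_below_Thin by metis
  qed
qed

lemma marking_below_antisym:
  assumes M: "marked_tubing V {} M" and N: "marked_tubing V {} N"
    and MN: "marking_below V M N" and NM: "marking_below V N M"
  shows "M = N"
proof
  fix u
  have V: "M V = N V"
    using marking_below_universal[OF MN] marking_below_universal[OF NM] by auto
  consider "u = V" | "u \<noteq> V" "M V = Some Thick" | "u \<noteq> V" "M V \<noteq> Some Thick" by blast
  then show "M u = N u"
  proof cases
    case 2
    with V show ?thesis
      using marking_below_thick[OF MN _ 2(1)] marking_below_thick[OF NM 2(2,1)]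
        node_below_antisym by simp
  next
    case 3
    with V have N': "N V \<noteq> Some Thick" by simp
    have "M u = Some Thin \<longleftrightarrow> N u = Some Thin"
      using marking_below_thin[OF MN N' 3(1)] marking_below_thin[OF NM 3(2,1)] by blast
    then show ?thesis
      using marked_tubing_edgeless_thin[OF M 3(2,1)] marked_tubing_edgeless_thin[OF N N' 3(1)]
      by auto
  qed (simp add: V)
qed

section \<open>Moves and the tube-by-tube order\<close>

lemma marking_move_imp_below:
  assumes "marking_move V {} M N" "marked_tubing V {} M"
  shows "marked_tubing V {} N \<and> marking_below V N M"
proof
  show mt: "marked_tubing V {} N" using assms(1) by (rule marking_move.cases) simp_all
  note thin = marked_tubing_edgeless_thin[OF assms(2)]
  have V: "M V \<noteq> None" using marked_tubing_edgeless_universal[OF assms(2)] by auto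
  from assms(1) show "marking_below V N M"
  proof cases
    case (resolve_broken u m)
    then have N: "N w = M w \<or> M w = Some Broken \<and> (N w = Some Thin \<or> N w = Some Thick)" for w
      by auto
    show ?thesis
    proof (rule marking_belowI)
      show "N V = M V \<or> M V = Some Broken" using N[of V] by auto
      show "node_below (N w) (M w)" for w using N[of w] by (auto simp: node_below_def)
      show "N w = Some Thin" if "M w = Some Thin" for w using N[of w] that by auto
    qed
  next
    case (add_thin u v)
    then have "v = V"
      using marked_tubing_edgeless_psubset[OF mt, of u v] by auto
    then show ?thesis using add_thin(1,3,4)
      by (intro marking_belowI) auto
  next
    case (add_thick u v)
    then have "v = V"
      using marked_tubing_edgeless_psubset[OF mt, of u v] by auto
    then show ?thesis using add_thick(1,3,4)
      by (intro marking_belowI) (auto simp: node_below_def)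
  next
    case (add_broken B v)
    then obtain u where "u \<in> B" "closely_nested (dom N) u v" by blast
    then have "v = V"
      using marked_tubing_edgeless_psubset[OF mt, of u v] by (simp add: closely_nested_def)
    then show ?thesis using add_broken(2-4)
      by (intro marking_belowI) auto
  qed
qed

text \<open>Applied to the intermediate tubings on the way down to \<open>M\<close>: a node left out
  by \<open>M\<close> is left out by every smaller set of tubes, so only the marking condition has
  to be checked again.\<close>

lemma marked_tubing_subset_dom:
  assumes M: "marked_tubing V {} M" and N: "V \<in> dom N" "dom N \<subseteq> dom M"
    and thin: "N V \<noteq> Some Thick \<Longrightarrow> \<forall>u. u \<noteq> V \<longrightarrow> N u = None \<or> N u = Some Thin"
  shows "marked_tubing V {} N"
  unfolding marked_tubing_edgeless
proof (intro conjI impI)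
  note M' = M[unfolded marked_tubing_edgeless]
  show "dom N \<subseteq> insert V ((\<lambda>v. {v}) ` V)"
    using M'[THEN conjunct2, THEN conjunct1] N(2) by (rule order_trans[rotated])
  obtain v where "v \<in> V" "V = {v} \<or> {v} \<notin> dom M"
    using M'[THEN conjunct2, THEN conjunct2, THEN conjunct1] by (elim bexE)
  then show "\<exists>v\<in>V. V = {v} \<or> {v} \<notin> dom N" using N(2) by blast
qed (use N thin in simp_all)

text \<open>The order of the moves matters: a broken \<open>V\<close> that has to become thick is resolved only
  after all thin nodes have been added, since no thin tube can be added inside a thick one.\<close>

lemma marking_below_step:
  assumes M: "marked_tubing V {} M" and N: "marked_tubing V {} N"
    and below: "marking_below V M N" and neq: "M \<noteq> N"
  obtains N' where "marking_move V {} N N'" "marked_tubing V {} N'" "marking_below V M N'"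
    "{w. N' w \<noteq> M w} \<subset> {w. N w \<noteq> M w}"
proof -
  note VM = marked_tubing_edgeless_universal[OF M] and VN = marked_tubing_edgeless_universal[OF N]
  have domNM: "M u \<noteq> None" if "N u \<noteq> None" for u
  proof (cases "u = V")
    case False
    then show ?thesis
      using that marking_below_thick[OF below _ False] marking_below_thin[OF below _ False]
        marked_tubing_edgeless_thin[OF N _ False]
      by (cases "N V = Some Thick") (auto simp: node_below_def)
  qed (use VM in auto)
  have sub: "u \<subset> V" if "u \<in> dom M" "u \<noteq> V" for u
    using marked_tubing_edgeless_tube[OF M that] that(2) by auto
  \<comment> \<open>Common pattern of all steps that change a single tube: \<open>u\<close> receives
    its final marking from \<open>M\<close>, so the set of disagreements loses \<open>u\<close> and
    gains nothing.\<close>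
  have upd: "\<exists>N'. marking_move V {} N N' \<and> marked_tubing V {} N' \<and> marking_below V M N' \<and>
      {w. N' w \<noteq> M w} \<subset> {w. N w \<noteq> M w}"
    if ne: "N u \<noteq> M u" and m: "M u = Some m"
      and move: "marked_tubing V {} (N(u \<mapsto> m)) \<Longrightarrow> marking_move V {} N (N(u \<mapsto> m))"
      and thin: "(N(u \<mapsto> m)) V \<noteq> Some Thick \<Longrightarrow>
         \<forall>w. w \<noteq> V \<longrightarrow> (N(u \<mapsto> m)) w = None \<or> (N(u \<mapsto> m)) w = Some Thin"
      and below': "marking_below V M (N(u \<mapsto> m))" for u m
  proof (intro exI conjI)
    have "dom N \<subseteq> dom M" using domNM by blast
    then have "dom (N(u \<mapsto> m)) \<subseteq> dom M" "V \<in> dom (N(u \<mapsto> m))" using m VN by auto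
    then show mt: "marked_tubing V {} (N(u \<mapsto> m))"
      by (intro marked_tubing_subset_dom[OF M] thin)
    show "marking_move V {} N (N(u \<mapsto> m))" by (rule move[OF mt])
    show "marking_below V M (N(u \<mapsto> m))" by (rule below')
    show "{w. (N(u \<mapsto> m)) w \<noteq> M w} \<subset> {w. N w \<noteq> M w}"
    proof
      show "{w. (N(u \<mapsto> m)) w \<noteq> M w} \<subseteq> {w. N w \<noteq> M w}" using ne by auto
      have "u \<in> {w. N w \<noteq> M w}" "u \<notin> {w. (N(u \<mapsto> m)) w \<noteq> M w}" using ne m by simp_all
      then show "{w. (N(u \<mapsto> m)) w \<noteq> M w} \<noteq> {w. N w \<noteq> M w}" by metis
    qed
  qed
  have "\<exists>N'. marking_move V {} N N' \<and> marked_tubing V {} N' \<and> marking_below V M N' \<and>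
      {w. N' w \<noteq> M w} \<subset> {w. N w \<noteq> M w}"
  proof (cases "N V = Some Thick")
    case thick: True
    then have VV: "M V = N V" using marking_below_universal[OF below] by simp
    obtain u where u: "M u \<noteq> N u" using neq by auto
    have "u \<noteq> V" using u VV by blast
    then have nb: "u \<noteq> V" "node_below (M u) (N u)"
      using marking_below_thick[OF below thick] by blast+
    then obtain m where m: "M u = Some m" using u by (auto simp: node_below_def)
    have "marking_move V {} N (N(u \<mapsto> m))" if mt: "marked_tubing V {} (N(u \<mapsto> m))"
    proof (cases "N u")
      case None
      then have "m = Thick" using nb m by (simp add: node_below_def)
      moreover have "u \<subset> V" using m nb(1) by (intro sub) auto
      ultimately show ?thesis using None thick mt by (intro add_thick[where v = V]) auto
    next
      case (Some a)
      then have "N u = Some Broken" "m = Thin \<or> m = Thick"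
        using nb m u by (auto simp: node_below_def)
      then show ?thesis using resolve_broken[OF _ _ refl mt] by blast
    qed
    moreover have "marking_below V M (N(u \<mapsto> m))"
      using below thick m nb(1) unfolding marking_below_def by (simp add: node_below_def)
    moreover have "(N(u \<mapsto> m)) V = Some Thick" using nb(1) thick by simp
    ultimately show ?thesis using upd[OF u[symmetric] m] by blast
  next
    case nthick: False
    have thinN: "N u = None \<or> N u = Some Thin" if "u \<noteq> V" for u
      using marked_tubing_edgeless_thin[OF N nthick that] .
    have thinM: "N u = Some Thin \<longrightarrow> M u = Some Thin" if "u \<noteq> V" for u
      using marking_below_thin[OF below nthick that] by blast
    have NV: "N V = Some Thin \<or> N V = Some Broken"
      using VN nthick by (metis domD marking.exhaust)
    show ?thesis
    proof (cases "\<exists>u. u \<noteq> V \<and> M u = Some Thin \<and> N u = None")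
      case True
      then obtain u where u: "u \<noteq> V" "M u = Some Thin" "N u = None" by auto
      have "marking_below V M (N(u \<mapsto> Thin))"
      proof (rule marking_belowI)
        fix w assume "w \<noteq> V" "(N(u \<mapsto> Thin)) w = Some Thin"
        then show "M w = Some Thin" using thinM[of w] u(2) by (cases "w = u") simp_all
      qed (use marking_below_universal[OF below] nthick u(1) in simp_all)
      moreover have "marking_move V {} N (N(u \<mapsto> Thin))" if "marked_tubing V {} (N(u \<mapsto> Thin))"
        using add_thin[of u N V "N(u \<mapsto> Thin)" V "{}"] that sub[OF _ u(1)] u NV by blast
      moreover have "\<forall>w. w \<noteq> V \<longrightarrow> (N(u \<mapsto> Thin)) w = None \<or> (N(u \<mapsto> Thin)) w = Some Thin"
        using thinN by simp
      ultimately show ?thesis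
        using upd[of u Thin] u by simp
    next
      case False
      then have same: "N u = Some Thin \<longleftrightarrow> M u = Some Thin" if "u \<noteq> V" for u
        using thinN[OF that] thinM[OF that] that by auto
      show ?thesis
      proof (cases "\<exists>u. u \<noteq> V \<and> M u = Some Broken")
        case nobroken: False
        \<comment> \<open>Thin nodes agree by now and no broken node is to come, so apart from
          \<open>V\<close> only thick nodes of \<open>M\<close> can be missing. Those require
          \<open>M V\<close> to be thick, so agreement at \<open>V\<close> would leave no difference
          at all.\<close>
        have "M V \<noteq> N V"
        proof
          assume eq: "M V = N V"
          have "M u = N u" for u
          proof (cases "u = V")
            case False
            then have "M u = None \<or> M u = Some Thin"
              using marked_tubing_edgeless_thin[OF M] eq nthick by simp
            then show ?thesis using same[OF False] thinN[OF False] by auto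
          qed (simp add: eq)
          with neq show False by auto
        qed
        then have NB: "N V = Some Broken" using marking_below_universal[OF below] by simp
        then obtain m where m: "M V = Some m" "m = Thin \<or> m = Thick"
          using VM \<open>M V \<noteq> N V\<close> by (metis domD marking.exhaust)
        have "node_below (M u) (N u)" if "u \<noteq> V" for u
        proof -
          have "M u \<noteq> Some Broken" using nobroken that by auto
          then have "M u = None \<or> M u = Some Thin \<or> M u = Some Thick"
            by (metis marking.exhaust option.exhaust)
          then show ?thesis using same[OF that] thinN[OF that] by (auto simp: node_below_def)
        qed
        then have below': "marking_below V M (N(V \<mapsto> m))"
          using thinM m(1) by (intro marking_belowI) simp_all
        have "marking_move V {} N (N(V \<mapsto> m))" if "marked_tubing V {} (N(V \<mapsto> m))"
          using resolve_broken[OF NB m(2) refl that] .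
        moreover have "\<forall>w. w \<noteq> V \<longrightarrow> (N(V \<mapsto> m)) w = None \<or> (N(V \<mapsto> m)) w = Some Thin"
          using thinN by simp
        ultimately show ?thesis
          using upd[OF \<open>M V \<noteq> N V\<close>[symmetric] m(1) _ _ below'] by blast
      next
        case True
        then have Mthick: "M V = Some Thick" using marked_tubing_edgeless_thin[OF M] by fastforce
        then have NB: "N V = Some Broken"
          using marking_below_universal[OF below] nthick by simp
        \<comment> \<open>Once \<open>V\<close> is thick, only thick tubes can be added. Hence all
          broken nodes of \<open>M\<close> must enter together, in the very move that makes
          \<open>V\<close> thick.\<close>
        define B where "B = {u. u \<noteq> V \<and> M u = Some Broken}"
        define N' where "N' = (\<lambda>w. if w \<in> B then Some Broken else if w = V then Some Thick else N w)"
        have BN: "N u = None" if "u \<in> B" for u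
          using that thinN[of u] thinM[of u] by (auto simp: B_def)
        have N'V: "N' V = Some Thick" by (auto simp: N'_def B_def)
        have dom': "dom N' \<subseteq> dom M"
          using domNM VM by (auto simp: N'_def B_def split: if_splits)
        have mt: "marked_tubing V {} N'"
          by (rule marked_tubing_subset_dom[OF M _ dom']) (use N'V in auto)
        have nested: "closely_nested (dom N') u V" if "u \<in> B" for u
        proof -
          have u: "u \<in> dom N'" "u \<subset> V" using that sub[of u] by (auto simp: N'_def B_def)
          have "\<not> (u \<subset> w \<and> w \<subset> V)" if w: "w \<in> dom N'" for w
          proof
            assume "u \<subset> w \<and> w \<subset> V"
            then show False using marked_tubing_edgeless_psubset[OF mt u(1) w] by auto
          qed
          then show ?thesis using u N'V by (auto simp: closely_nested_def)
        qed
        have "B \<noteq> {}" using True by (auto simp: B_def)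
        moreover have "B \<inter> dom N = {}" using BN by auto
        ultimately have "marking_move V {} N N'"
          by (rule add_broken[OF _ _ NB N'_def _ mt]) (use nested in blast)
        moreover have "marking_below V M N'"
        proof (rule marking_belowI)
          fix u assume "u \<noteq> V"
          show "node_below (M u) (N' u)"
          proof (cases "u \<in> B")
            case False
            then have "M u \<noteq> Some Broken" using \<open>u \<noteq> V\<close> by (simp add: B_def)
            then have "M u = None \<or> M u = Some Thin \<or> M u = Some Thick"
              by (metis marking.exhaust option.exhaust)
            moreover have "N' u = N u" using False \<open>u \<noteq> V\<close> by (simp add: N'_def)
            ultimately show ?thesis using same[OF \<open>u \<noteq> V\<close>] thinN[OF \<open>u \<noteq> V\<close>]
              by (auto simp: node_below_def)
          qed (simp add: B_def N'_def node_below_def)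
        qed (simp_all add: N'V Mthick)
        moreover have "{w. N' w \<noteq> M w} \<subset> {w. N w \<noteq> M w}"
        proof
          show "{w. N' w \<noteq> M w} \<subseteq> {w. N w \<noteq> M w}"
            using Mthick by (auto simp: N'_def B_def)
          show "{w. N' w \<noteq> M w} \<noteq> {w. N w \<noteq> M w}"
            using N'V Mthick nthick by (auto simp: set_eq_iff intro!: exI[of _ V])
        qed
        ultimately show ?thesis using mt by blast
      qed
    qed
  qed
  then show thesis using that by blast
qed

text \<open>Replaces reachability by a condition on single tubes, which can be compared with
  inequalities. The converse iterates \<open>marking_below_step\<close>; this ends because the set
  of disagreements is finite and shrinks strictly.\<close>

lemma marking_le_iff_below:
  assumes V: "finite V" and M: "marked_tubing V {} M" and N: "marked_tubing V {} N"
  shows "marking_le V {} M N \<longleftrightarrow> marking_below V M N"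
proof
  assume "marking_le V {} M N"
  then have "(marking_move V {})\<^sup>*\<^sup>* N M" by (simp add: marking_le_def)
  then have "marked_tubing V {} M \<and> marking_below V M N"
  proof (induction rule: rtranclp_induct)
    case base
    show ?case using N marking_below_refl by (rule conjI)
  next
    case (step L M)
    then have "marked_tubing V {} M \<and> marking_below V M L"
      by (intro marking_move_imp_below) simp_all
    with step.IH show ?case using marking_below_trans by blast
  qed
  then show "marking_below V M N" by (rule conjunct2)
next
  have fin: "finite {w. L w \<noteq> M w}" if L: "marked_tubing V {} L" for L
  proof (rule finite_subset)
    show "{w. L w \<noteq> M w} \<subseteq> insert V ((\<lambda>v. {v}) ` V)"
    proof
      fix w assume "w \<in> {w. L w \<noteq> M w}"
      then have "w \<in> dom L \<or> w \<in> dom M" by (auto simp: domIff)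
      then show "w \<in> insert V ((\<lambda>v. {v}) ` V)"
        using marked_tubing_edgeless_tube[OF L, of w] marked_tubing_edgeless_tube[OF M, of w]
        by blast
    qed
  qed (use V in simp)
  assume "marking_below V M N"
  then have "(marking_move V {})\<^sup>*\<^sup>* N M"
    using N
  proof (induction "card {w. N w \<noteq> M w}" arbitrary: N rule: less_induct)
    case less
    show ?case
    proof (cases "M = N")
      case False
      obtain N' where N': "marking_move V {} N N'" "marked_tubing V {} N'" "marking_below V M N'"
        "{w. N' w \<noteq> M w} \<subset> {w. N w \<noteq> M w}"
        using marking_below_step[OF M less.prems(2,1) False] .
      have "card {w. N' w \<noteq> M w} < card {w. N w \<noteq> M w}"
        by (rule psubset_card_mono[OF fin[OF less.prems(2)] N'(4)])
      then have "(marking_move V {})\<^sup>*\<^sup>* N' M" using N'(3,2) by (rule less.hyps)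
      with N'(1) show ?thesis by (rule converse_rtranclp_into_rtranclp)
    qed simp
  qed
  then show "marking_le V {} M N" by (simp add: marking_le_def)
qed

section \<open>Face posets and posets of types\<close>

lemma posets_isomorphic_sym:
  assumes "posets_isomorphic A le B le'"
  shows "posets_isomorphic B le' A le"
proof -
  obtain f where f: "bij_betw f A B" and le: "\<And>x y. x \<in> A \<Longrightarrow> y \<in> A \<Longrightarrow> le x y \<longleftrightarrow> le' (f x) (f y)"
    using assms unfolding posets_isomorphic_def by metis
  have "le' x y \<longleftrightarrow> le (inv_into A f x) (inv_into A f y)" if "x \<in> B" "y \<in> B" for x y
    using le[of "inv_into A f x" "inv_into A f y"] f that
    by (simp add: bij_betw_def inv_into_into f_inv_into_f)
  then show ?thesis
    using bij_betw_inv_into[OF f] unfolding posets_isomorphic_def by blast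
qed

lemma posets_isomorphic_trans:
  assumes "posets_isomorphic A le B le'" "posets_isomorphic B le' C le''"
  shows "posets_isomorphic A le C le''"
proof -
  obtain f where f: "bij_betw f A B" and 1: "\<And>x y. x \<in> A \<Longrightarrow> y \<in> A \<Longrightarrow> le x y \<longleftrightarrow> le' (f x) (f y)"
    using assms(1) unfolding posets_isomorphic_def by metis
  obtain h where h: "bij_betw h B C" and 2: "\<And>x y. x \<in> B \<Longrightarrow> y \<in> B \<Longrightarrow> le' x y \<longleftrightarrow> le'' (h x) (h y)"
    using assms(2) unfolding posets_isomorphic_def by metis
  have "le x y \<longleftrightarrow> le'' ((h \<circ> f) x) ((h \<circ> f) y)" if "x \<in> A" "y \<in> A" for x y
    using 1[OF that] 2[of "f x" "f y"] that bij_betwE[OF f] by simp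
  then show ?thesis
    using bij_betw_trans[OF f h] unfolding posets_isomorphic_def by blast
qed

text \<open>The points of type at most \<open>t x\<close> form the smallest face containing \<open>x\<close>: they form a face,
  and by \<open>prolong\<close> each of them is an end point of a segment in \<open>P\<close> through \<open>x\<close>.\<close>

lemma nonempty_faces_isomorphic_types:
  fixes P :: "'a::euclidean_space set" and t :: "'a \<Rightarrow> 'b"
  assumes types: "t ` P = X"
    and refl: "\<And>m. m \<in> X \<Longrightarrow> le m m"
    and trans: "\<And>l m n. l \<in> X \<Longrightarrow> m \<in> X \<Longrightarrow> n \<in> X \<Longrightarrow> le l m \<Longrightarrow> le m n \<Longrightarrow> le l n"
    and antisym: "\<And>m n. m \<in> X \<Longrightarrow> n \<in> X \<Longrightarrow> le m n \<Longrightarrow> le n m \<Longrightarrow> m = n"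
    and face: "\<And>x. x \<in> P \<Longrightarrow> {y \<in> P. le (t y) (t x)} face_of P"
    and prolong: "\<And>x y. x \<in> P \<Longrightarrow> y \<in> P \<Longrightarrow> le (t y) (t x) \<Longrightarrow> \<exists>e>0. x + e *\<^sub>R (x - y) \<in> P"
  shows "posets_isomorphic (nonempty_faces P) (\<subseteq>) X le"
proof -
  define G where "G m = {y \<in> P. le (t y) m}" for m
  have tX: "t x \<in> X" if "x \<in> P" for x using that types by blast
  have G_mono: "le m n \<longleftrightarrow> G m \<subseteq> G n" if "m \<in> X" "n \<in> X" for m n
  proof
    assume "le m n"
    then show "G m \<subseteq> G n" unfolding G_def using trans tX that by blast
  next
    assume *: "G m \<subseteq> G n"
    obtain x where x: "x \<in> P" "t x = m" using types \<open>m \<in> X\<close> by blast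
    then have "x \<in> G m" using refl \<open>m \<in> X\<close> by (simp add: G_def)
    with * x show "le m n" by (auto simp: G_def)
  qed
  have "inj_on G X"
  proof (rule inj_onI)
    fix m n assume mn: "m \<in> X" "n \<in> X" "G m = G n"
    then show "m = n"
      using antisym[OF mn(1,2)] G_mono[OF mn(1,2)] G_mono[OF mn(2,1)] by simp
  qed
  moreover have "G ` X = nonempty_faces P"
  proof
    show "G ` X \<subseteq> nonempty_faces P"
    proof (rule image_subsetI)
      fix m assume m: "m \<in> X"
      then obtain x where x: "x \<in> P" "t x = m" using types by blast
      then have "x \<in> G m" using refl m by (simp add: G_def)
      then show "G m \<in> nonempty_faces P"
        using face[OF x(1)] x(2) by (auto simp: nonempty_faces_def G_def)
    qed
    show "nonempty_faces P \<subseteq> G ` X"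
    proof
      fix F assume "F \<in> nonempty_faces P"
      then have F: "F face_of P" "F \<noteq> {}" by (auto simp: nonempty_faces_def)
      \<comment> \<open>Any relative interior point identifies its face, so \<open>F\<close> will
        turn out to be \<open>G (t x)\<close>. One inclusion holds because a face that meets the
        relative interior of \<open>F\<close> contains \<open>F\<close>.\<close>
      then obtain x where xri: "x \<in> rel_interior F"
        using rel_interior_eq_empty face_of_imp_convex by blast
      then have xF: "x \<in> F" using rel_interior_subset by blast
      then have xP: "x \<in> P" using face_of_imp_subset[OF F(1)] by blast
      have "F \<subseteq> G (t x)"
      proof (rule subset_of_face_of)
        show "G (t x) face_of P" unfolding G_def by (rule face[OF xP])
        show "F \<subseteq> P" by (rule face_of_imp_subset[OF F(1)])
        have "x \<in> G (t x)" using refl[OF tX[OF xP]] xP by (simp add: G_def)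
        then show "G (t x) \<inter> rel_interior F \<noteq> {}" using xri by blast
      qed
      moreover have "G (t x) \<subseteq> F"
      proof
        fix y assume "y \<in> G (t x)"
        then have y: "y \<in> P" "le (t y) (t x)" by (auto simp: G_def)
        obtain e where e: "e > 0" "x + e *\<^sub>R (x - y) \<in> P" using prolong[OF xP y] by blast
        define z where "z = x + e *\<^sub>R (x - y)"
        show "y \<in> F"
        proof (cases "y = x")
          case False
          \<comment> \<open>\<open>x\<close> lies strictly between \<open>y\<close> and the
            prolonged point \<open>z\<close>, so a face containing \<open>x\<close> also contains
            \<open>y\<close>.\<close>
          have "x = (1 - 1 / (1 + e)) *\<^sub>R y + (1 / (1 + e)) *\<^sub>R z"
          proof -
            have "(1 + e) *\<^sub>R x = e *\<^sub>R y + z" by (simp add: z_def algebra_simps)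
            then have "(1 / (1 + e)) *\<^sub>R (1 + e) *\<^sub>R x = (1 / (1 + e)) *\<^sub>R (e *\<^sub>R y + z)"
              by simp
            then have "x = (1 / (1 + e)) *\<^sub>R (e *\<^sub>R y + z)" using e(1) by simp
            moreover have "1 - 1 / (1 + e) = e / (1 + e)" using e(1) by (simp add: field_simps)
            ultimately show ?thesis by (simp add: scaleR_right_distrib)
          qed
          moreover have "0 < 1 / (1 + e)" "1 / (1 + e) < 1" using e(1) by simp_all
          moreover have "y \<noteq> z"
          proof
            assume "y = z"
            then have "(1 + e) *\<^sub>R (x - y) = 0" by (simp add: z_def algebra_simps)
            with e(1) False show False by simp
          qed
          ultimately have "x \<in> open_segment y z" unfolding in_segment by blast
          then show ?thesis using face_ofD[OF F(1) _ y(1) _ xF] e(2) z_def by blast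
        qed (use xF in simp)
      qed
      ultimately show "F \<in> G ` X" using tX[OF xP] by blast
    qed
  qed
  ultimately have "posets_isomorphic X le (nonempty_faces P) (\<subseteq>)"
    unfolding posets_isomorphic_def bij_betw_def using G_mono by (intro exI[of _ G]) simp
  then show ?thesis by (rule posets_isomorphic_sym)
qed

section \<open>The Minkowski sum\<close>

definition coord_sum :: "real ^ 'n \<Rightarrow> real" where
  "coord_sum x = (\<Sum>i\<in>UNIV. x $ i)"

definition excess :: "real ^ 'n \<Rightarrow> real" where
  "excess x = (\<Sum>i\<in>UNIV. max 0 (x $ i - 1))"

definition sum_body :: "(real ^ 'n) set" where
  "sum_body = {x. (\<forall>i. 0 \<le> x $ i) \<and> 1 \<le> coord_sum x \<and> excess x \<le> 1}"

lemma sum_bodyD: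
  assumes "x \<in> sum_body"
  shows "0 \<le> x $ i" "1 \<le> coord_sum x" "excess x \<le> 1"
  using assms by (auto simp: sum_body_def)

text \<open>In a sum \<open>a + b\<close> the coordinates of \<open>b\<close> are at most 1, so
  \<open>a\<close> carries at least the part of each coordinate above 1, and these parts total at
  most 1. Conversely, cutting every coordinate at 1 gives a valid decomposition.\<close>

lemma cube_simplex_plus_cube_minus_simplex:
  "(cube_simplex :: (real ^ 'n) set) + cube_minus_simplex = sum_body"
proof
  show "(cube_simplex :: (real ^ 'n) set) + cube_minus_simplex \<subseteq> sum_body"
  proof
    fix x :: "real ^ 'n" assume "x \<in> cube_simplex + cube_minus_simplex"
    then obtain a b where x: "x = a + b"
      and a: "\<And>i. 0 \<le> a $ i" "(\<Sum>i\<in>UNIV. a $ i) \<le> 1"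
      and b: "\<And>i. 0 \<le> b $ i" "\<And>i. b $ i \<le> 1" "1 \<le> (\<Sum>i\<in>UNIV. b $ i)"
      by (auto simp: set_plus_def cube_simplex_def cube_minus_simplex_def unit_cube_def)
    have "(\<Sum>i\<in>UNIV. b $ i) \<le> coord_sum x"
      unfolding coord_sum_def x by (rule sum_mono) (simp add: a)
    moreover have "excess x \<le> (\<Sum>i\<in>UNIV. a $ i)"
      unfolding excess_def x
    proof (rule sum_mono)
      show "max 0 ((a + b) $ i - 1) \<le> a $ i" for i using a(1)[of i] b(2)[of i] by simp
    qed
    ultimately show "x \<in> sum_body" using a b by (simp add: sum_body_def x)
  qed
  show "sum_body \<subseteq> (cube_simplex :: (real ^ 'n) set) + cube_minus_simplex"
  proof
    fix x :: "real ^ 'n" assume x: "x \<in> sum_body"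
    define a :: "real ^ 'n" where "a = (\<chi> i. max 0 (x $ i - 1))"
    define b :: "real ^ 'n" where "b = (\<chi> i. min 1 (x $ i))"
    have suma: "(\<Sum>i\<in>UNIV. a $ i) \<le> 1" using sum_bodyD(3)[OF x] by (simp add: a_def excess_def)
    have "a $ i \<le> 1" for i
      using member_le_sum[of i UNIV "\<lambda>i. a $ i"] suma by (simp add: a_def)
    then have "a \<in> cube_simplex" using suma by (simp add: cube_simplex_def unit_cube_def a_def)
    moreover have "1 \<le> (\<Sum>i\<in>UNIV. b $ i)"
    \<comment> \<open>Either one coordinate of \<open>b\<close> is already 1, or nothing was cut off
      and \<open>b\<close> equals \<open>x\<close>.\<close>
    proof (cases "\<exists>i. 1 \<le> x $ i")
      case True
      then obtain i where "1 \<le> x $ i" by blast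
      then show ?thesis
        using member_le_sum[of i UNIV "\<lambda>i. b $ i"] sum_bodyD(1)[OF x] by (simp add: b_def)
    next
      case False
      then have "b $ i = x $ i" for i by (simp add: b_def not_le less_imp_le)
      then show ?thesis using sum_bodyD(2)[OF x] by (simp add: coord_sum_def)
    qed
    then have "b \<in> cube_minus_simplex"
      using sum_bodyD(1)[OF x] by (simp add: cube_minus_simplex_def unit_cube_def b_def)
    moreover have "x = a + b" by (auto simp: vec_eq_iff a_def b_def max_def min_def)
    ultimately show "x \<in> cube_simplex + cube_minus_simplex" by blast
  qed
qed

lemma polytope_set_plus: "polytope S \<Longrightarrow> polytope T \<Longrightarrow> polytope (S + T)"
  unfolding polytope_def by (metis convex_hull_set_plus finite_set_plus)

lemma polytope_sum_body: "polytope (sum_body :: (real ^ 'n) set)"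
  using polytope_set_plus[OF polytope_cube_simplex polytope_cube_minus_simplex]
  by (simp add: cube_simplex_plus_cube_minus_simplex)

lemma aff_dim_sum_body: "aff_dim (sum_body :: (real ^ 'n) set) = int CARD('n)"
proof -
  \<comment> \<open>Above \<open>l\<close> every coordinate exceeds 1, which settles the lower bound
    on the sum; below \<open>u\<close> the \<open>CARD('n)\<close> overshoots are each less than
    \<open>1 / CARD('n)\<close>, hence total at most 1.\<close>
  define l u :: "real ^ 'n" where "l = (\<chi> i. 1)" and "u = (\<chi> i. 1 + 1 / CARD('n))"
  have "box l u \<subseteq> sum_body"
  proof
    fix x assume "x \<in> box l u"
    then have x: "1 < x $ i" "x $ i < 1 + 1 / CARD('n)" for i
      by (auto simp: mem_box_cart l_def u_def)
    have "1 \<le> coord_sum x"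
    proof -
      have "(\<Sum>i\<in>(UNIV :: 'n set). 1) \<le> coord_sum x"
        unfolding coord_sum_def using x(1) by (intro sum_mono) (simp add: less_imp_le)
      moreover have "1 \<le> real CARD('n)" by (simp add: Suc_leI)
      moreover have "(\<Sum>i\<in>(UNIV :: 'n set). 1) = real CARD('n)" by simp
      ultimately show ?thesis by linarith
    qed
    moreover have "excess x \<le> (\<Sum>i\<in>(UNIV :: 'n set). 1 / CARD('n))"
      unfolding excess_def
    proof (rule sum_mono)
      show "max 0 (x $ i - 1) \<le> 1 / CARD('n)" for i using x[of i] by simp
    qed
    moreover have "0 \<le> x $ i" for i using x(1)[of i] by simp
    ultimately show "x \<in> sum_body" by (simp add: sum_body_def)
  qed
  moreover have "(\<chi> i. 1 + 1 / (2 * CARD('n))) \<in> box l u"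
    by (simp add: mem_box_cart l_def u_def field_simps)
  ultimately have "interior (sum_body :: (real ^ 'n) set) \<noteq> {}"
    using interior_maximal[OF _ open_box] by blast
  then show ?thesis by (simp add: aff_dim_nonempty_interior)
qed

section \<open>Faces of the sum and tight inequalities\<close>

lemma excess_segment_le:
  assumes "0 \<le> u" "u \<le> 1"
  shows "max 0 (((1 - u) *\<^sub>R a + u *\<^sub>R b) $ i - 1) \<le> (1 - u) * max 0 (a $ i - 1) + u * max 0 (b $ i - 1)"
proof -
  have "(1 - u) * (a $ i - 1) \<le> (1 - u) * max 0 (a $ i - 1)" "u * (b $ i - 1) \<le> u * max 0 (b $ i - 1)"
    "0 \<le> (1 - u) * max 0 (a $ i - 1)" "0 \<le> u * max 0 (b $ i - 1)"
    using assms by (auto intro!: mult_left_mono)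
  moreover have "((1 - u) *\<^sub>R a + u *\<^sub>R b) $ i - 1 = (1 - u) * (a $ i - 1) + u * (b $ i - 1)"
    by (simp add: algebra_simps)
  ultimately show ?thesis by linarith
qed

lemma coord_sum_segment: "coord_sum ((1 - u) *\<^sub>R a + u *\<^sub>R b) = (1 - u) * coord_sum a + u * coord_sum b"
  by (simp add: coord_sum_def sum.distrib sum_distrib_left)

text \<open>Every facet inequality that is tight at \<open>x\<close> is tight at \<open>y\<close>.  For the inequalities
  \<open>(\<Sum>i\<in>A. x $ i - 1) \<le> 1\<close> the last clause says this without mentioning the sets \<open>A\<close>: they
  are tight iff \<open>excess x = 1\<close> and \<open>{i. 1 < x $ i} \<subseteq> A \<subseteq> {i. 1 \<le> x $ i}\<close>.\<close>

definition tight_below :: "real ^ 'n \<Rightarrow> real ^ 'n \<Rightarrow> bool" where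
  "tight_below y x \<longleftrightarrow> (\<forall>i. x $ i = 0 \<longrightarrow> y $ i = 0) \<and> (coord_sum x = 1 \<longrightarrow> coord_sum y = 1) \<and>
     (excess x = 1 \<longrightarrow>
       excess y = 1 \<and> (\<forall>i. (x $ i \<le> 1 \<longrightarrow> y $ i \<le> 1) \<and> (1 \<le> x $ i \<longrightarrow> 1 \<le> y $ i)))"

lemma tight_below_trans: "tight_below x y \<Longrightarrow> tight_below y z \<Longrightarrow> tight_below x z"
  by (simp add: tight_below_def)

text \<open>A convex combination with positive weights of values bounded by \<open>c\<close> equals
  \<open>c\<close> only if both values do (\<open>conv\<close>). So an inequality tight inside a
  segment is tight at both ends. As \<open>excess\<close> is convex but not linear, its equality
  case is also analysed coordinate by coordinate.\<close>

lemma tight_below_open_segment: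
  assumes a: "a \<in> sum_body" and b: "b \<in> sum_body" and u: "0 < u" "u < 1"
    and x: "x = (1 - u) *\<^sub>R a + u *\<^sub>R b"
  shows "tight_below a x \<and> tight_below b x"
proof -
  have conv: "p = c \<and> q = c"
    if "(1 - u) * p + u * q = c" "p \<le> c" "q \<le> c" for p q c :: real
  proof -
    have "(1 - u) * (c - p) + u * (c - q) = 0" using that(1) by (simp add: algebra_simps)
    moreover have "0 \<le> (1 - u) * (c - p)" "0 \<le> u * (c - q)" using that u by simp_all
    ultimately have "(1 - u) * (c - p) = 0" "u * (c - q) = 0" by linarith+
    then show ?thesis using u by simp
  qed
  have zero: "a $ i = 0 \<and> b $ i = 0" if "x $ i = 0" for i
    using conv[of "- a $ i" "- b $ i" 0] that sum_bodyD(1)[OF a, of i] sum_bodyD(1)[OF b, of i]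
    by (simp add: x)
  have one: "coord_sum a = 1 \<and> coord_sum b = 1" if "coord_sum x = 1"
    using conv[of "- coord_sum a" "- coord_sum b" "- 1"] that sum_bodyD(2)[OF a] sum_bodyD(2)[OF b]
      coord_sum_segment[of u a b] by (simp add: x)
  have exc: "excess a = 1 \<and> excess b = 1 \<and>
      (\<forall>i. (x $ i \<le> 1 \<longrightarrow> a $ i \<le> 1 \<and> b $ i \<le> 1) \<and> (1 \<le> x $ i \<longrightarrow> 1 \<le> a $ i \<and> 1 \<le> b $ i))"
    if e: "excess x = 1"
  proof -
    \<comment> \<open>\<open>d i\<close> is the convexity defect of the overshoot in coordinate
      \<open>i\<close>. The defects are nonnegative, and their sum is at most 0 because
      \<open>excess x\<close> has the maximal value 1; so all of them vanish.\<close>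
    define d where "d i = (1 - u) * max 0 (a $ i - 1) + u * max 0 (b $ i - 1) - max 0 (x $ i - 1)" for i
    have d0: "0 \<le> d i" for i
      using excess_segment_le[of u a b i] u by (simp add: d_def x)
    have sumd: "(\<Sum>i\<in>UNIV. d i) = (1 - u) * excess a + u * excess b - excess x"
      by (simp add: d_def excess_def sum.distrib sum_subtractf sum_distrib_left)
    have le: "(1 - u) * excess a \<le> 1 - u" "u * excess b \<le> u"
      using u sum_bodyD(3)[OF a] sum_bodyD(3)[OF b] by (simp_all add: mult_left_le)
    have ge: "0 \<le> (\<Sum>i\<in>UNIV. d i)" using d0 by (simp add: sum_nonneg)
    have "(1 - u) * excess a + u * excess b = 1" using le ge sumd e by linarith
    then have ab: "excess a = 1 \<and> excess b = 1"
      using conv sum_bodyD(3)[OF a] sum_bodyD(3)[OF b] by blast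
    then have "(\<Sum>i\<in>UNIV. d i) = 0" using sumd e by simp
    then have d: "d i = 0" for i using d0 by (simp add: sum_nonneg_eq_0_iff)
    have "(x $ i \<le> 1 \<longrightarrow> a $ i \<le> 1 \<and> b $ i \<le> 1) \<and> (1 \<le> x $ i \<longrightarrow> 1 \<le> a $ i \<and> 1 \<le> b $ i)" for i
    proof (intro conjI impI)
      assume xi: "x $ i \<le> 1"
      then have "(1 - u) * (- max 0 (a $ i - 1)) + u * (- max 0 (b $ i - 1)) = 0"
        using d[of i] by (simp add: d_def)
      then have "- max 0 (a $ i - 1) = 0 \<and> - max 0 (b $ i - 1) = 0" by (rule conv) simp_all
      then show "a $ i \<le> 1" "b $ i \<le> 1" by linarith+
    next
      assume xi: "1 \<le> x $ i"
      \<comment> \<open>For \<open>1 \<le> x $ i\<close> the overshoot of \<open>x\<close> is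
        \<open>x $ i - 1\<close> itself, so a vanishing defect says that a weighted sum of two
        nonpositive numbers is 0.\<close>
      have "(1 - u) * (a $ i - 1 - max 0 (a $ i - 1)) + u * (b $ i - 1 - max 0 (b $ i - 1)) = 0"
        using d[of i] xi by (simp add: d_def x algebra_simps)
      then have "a $ i - 1 - max 0 (a $ i - 1) = 0 \<and> b $ i - 1 - max 0 (b $ i - 1) = 0"
        by (rule conv) simp_all
      then show "1 \<le> a $ i" "1 \<le> b $ i" by linarith+
    qed
    with ab show ?thesis by blast
  qed
  show ?thesis using zero one exc by (simp add: tight_below_def)
qed

text \<open>The delicate condition is \<open>excess y = 1\<close>, since \<open>excess\<close> is
  not affine. If it is required, the side conditions place \<open>a $ i\<close> and
  \<open>b $ i\<close> on a common side of 1, where the overshoot is affine along the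
  segment.\<close>

lemma convex_tight_below: "convex {y \<in> sum_body. tight_below y x}"
  unfolding convex_alt
proof (intro ballI allI impI)
  fix a b u
  assume a: "a \<in> {y \<in> sum_body. tight_below y x}" and b: "b \<in> {y \<in> sum_body. tight_below y x}"
    and u: "0 \<le> u \<and> u \<le> (1 :: real)"
  define z where "z = (1 - u) *\<^sub>R a + u *\<^sub>R b"
  have z: "z \<in> sum_body"
    using polytope_imp_convex[OF polytope_sum_body, unfolded convex_alt] a b u
    unfolding z_def by blast
  have comb: "(1 - u) * p + u * q \<le> c" if "p \<le> c" "q \<le> c" for p q c :: real
    using convex_bound_le[OF that, of "1 - u" u] u by simp
  have side: "z $ i \<le> 1" if "a $ i \<le> 1" "b $ i \<le> 1" for i
    using comb[OF that] by (simp add: z_def)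
  have side': "1 \<le> z $ i" if "1 \<le> a $ i" "1 \<le> b $ i" for i
    using comb[of "- a $ i" "- 1" "- b $ i"] that by (simp add: z_def)
  have "tight_below z x"
    unfolding tight_below_def
  proof (intro conjI allI impI)
    show "z $ i = 0" if "x $ i = 0" for i using a b that by (simp add: tight_below_def z_def)
    show "coord_sum z = 1" if "coord_sum x = 1"
      using a b that by (simp add: tight_below_def z_def coord_sum_segment)
    show "z $ i \<le> 1" if "excess x = 1" "x $ i \<le> 1" for i
      using a b that by (intro side) (simp_all add: tight_below_def)
    show "1 \<le> z $ i" if "excess x = 1" "1 \<le> x $ i" for i
      using a b that by (intro side') (simp_all add: tight_below_def)
    show "excess z = 1" if e: "excess x = 1"
    proof -
      have "max 0 (z $ i - 1) = (1 - u) * max 0 (a $ i - 1) + u * max 0 (b $ i - 1)" for i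
      proof (cases "x $ i \<le> 1")
        case True
        then have "a $ i \<le> 1" "b $ i \<le> 1" using a b e by (simp_all add: tight_below_def)
        then show ?thesis using side[of i] by simp
      next
        case False
        then have "1 \<le> a $ i" "1 \<le> b $ i" using a b e by (simp_all add: tight_below_def)
        then show ?thesis using side'[of i] by (simp add: z_def algebra_simps)
      qed
      then have "excess z = (1 - u) * excess a + u * excess b"
        by (simp add: excess_def sum.distrib sum_distrib_left)
      then show ?thesis using a b e by (simp add: tight_below_def)
    qed
  qed
  with z show "(1 - u) *\<^sub>R a + u *\<^sub>R b \<in> {y \<in> sum_body. tight_below y x}"
    by (simp add: z_def)
qed

lemma tight_below_face_of: "{y \<in> sum_body. tight_below y x} face_of sum_body"
  unfolding face_of_def
proof (intro conjI ballI impI)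
  fix a b z
  assume "a \<in> sum_body" "b \<in> sum_body" "z \<in> {y \<in> sum_body. tight_below y x}" "z \<in> open_segment a b"
  then have "tight_below a x \<and> tight_below b x"
    using tight_below_open_segment tight_below_trans unfolding in_segment by blast
  with \<open>a \<in> sum_body\<close> \<open>b \<in> sum_body\<close>
  show "a \<in> {y \<in> sum_body. tight_below y x}" "b \<in> {y \<in> sum_body. tight_below y x}" by simp_all
qed (use convex_tight_below in auto)

text \<open>Inequalities strict at \<open>x\<close> survive a short move by continuity. Those tight
  at \<open>x\<close> are tight at \<open>y\<close> too, and remain tight on the prolonged
  segment.\<close>

lemma tight_below_prolong:
  assumes x: "x \<in> sum_body" and y: "y \<in> sum_body" and yx: "tight_below y x"
  shows "\<exists>e>0. x + e *\<^sub>R (x - y) \<in> sum_body"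
proof -
  define z where "z e = x + e *\<^sub>R (x - y)" for e :: real
  have tz: "((\<lambda>e. z e $ i) \<longlongrightarrow> x $ i) (at_right 0)" for i
    unfolding z_def by (auto intro!: tendsto_eq_intros)
  have tt: "((\<lambda>e. coord_sum (z e)) \<longlongrightarrow> coord_sum x) (at_right 0)"
    unfolding coord_sum_def by (intro tendsto_sum tz)
  have te: "((\<lambda>e. excess (z e)) \<longlongrightarrow> excess x) (at_right 0)"
    unfolding excess_def by (intro tendsto_sum tendsto_max tendsto_diff tz tendsto_const)
  have "\<forall>\<^sub>F e in at_right 0. \<forall>i. (0 < x $ i \<longrightarrow> 0 < z e $ i) \<and> (x $ i < 1 \<longrightarrow> z e $ i < 1) \<and>
      (1 < x $ i \<longrightarrow> 1 < z e $ i)"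
  proof (rule eventually_all_finite)
    fix i
    have "\<forall>\<^sub>F e in at_right 0. 0 < x $ i \<longrightarrow> 0 < z e $ i"
      using order_tendstoD(1)[OF tz, of 0 i] by (cases "0 < x $ i") simp_all
    moreover have "\<forall>\<^sub>F e in at_right 0. x $ i < 1 \<longrightarrow> z e $ i < 1"
      using order_tendstoD(2)[OF tz, of i 1] by (cases "x $ i < 1") simp_all
    moreover have "\<forall>\<^sub>F e in at_right 0. 1 < x $ i \<longrightarrow> 1 < z e $ i"
      using order_tendstoD(1)[OF tz, of 1 i] by (cases "1 < x $ i") simp_all
    ultimately show "\<forall>\<^sub>F e in at_right 0. (0 < x $ i \<longrightarrow> 0 < z e $ i) \<and> (x $ i < 1 \<longrightarrow> z e $ i < 1) \<and>
      (1 < x $ i \<longrightarrow> 1 < z e $ i)" by (intro eventually_conj)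
  qed
  moreover have "\<forall>\<^sub>F e in at_right 0. 1 < coord_sum x \<longrightarrow> 1 < coord_sum (z e)"
    using order_tendstoD(1)[OF tt, of 1] by (cases "1 < coord_sum x") simp_all
  moreover have "\<forall>\<^sub>F e in at_right 0. excess x < 1 \<longrightarrow> excess (z e) < 1"
    using order_tendstoD(2)[OF te, of 1] by (cases "excess x < 1") simp_all
  moreover have "\<forall>\<^sub>F e in at_right (0::real). 0 < e"
    by (rule eventually_at_right_less)
  ultimately have "\<forall>\<^sub>F e in at_right 0. 0 < e \<and> (1 < coord_sum x \<longrightarrow> 1 < coord_sum (z e)) \<and>
      (excess x < 1 \<longrightarrow> excess (z e) < 1) \<and>
      (\<forall>i. (0 < x $ i \<longrightarrow> 0 < z e $ i) \<and> (x $ i < 1 \<longrightarrow> z e $ i < 1) \<and> (1 < x $ i \<longrightarrow> 1 < z e $ i))"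
    by (intro eventually_conj)
  then obtain e where e: "0 < e" and et: "1 < coord_sum x \<longrightarrow> 1 < coord_sum (z e)"
    and ee: "excess x < 1 \<longrightarrow> excess (z e) < 1"
    and ei: "\<And>i. 0 < x $ i \<Longrightarrow> 0 < z e $ i" "\<And>i. x $ i < 1 \<Longrightarrow> z e $ i < 1"
      "\<And>i. 1 < x $ i \<Longrightarrow> 1 < z e $ i"
    using eventually_happens'[OF trivial_limit_at_right_real] by blast
  have "0 \<le> z e $ i" for i
  proof (cases "x $ i = 0")
    case True
    then show ?thesis using yx by (simp add: tight_below_def z_def)
  next
    case False
    then show ?thesis using ei(1)[of i] sum_bodyD(1)[OF x, of i] by simp
  qed
  moreover have "1 \<le> coord_sum (z e)"
  proof (cases "coord_sum x = 1")
    case True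
    then have "coord_sum y = 1" using yx by (simp add: tight_below_def)
    moreover have "coord_sum (z e) = coord_sum x + e * (coord_sum x - coord_sum y)"
      by (simp add: z_def coord_sum_def sum.distrib sum_subtractf sum_distrib_left algebra_simps)
    ultimately show ?thesis using True by simp
  next
    case False
    then show ?thesis using et sum_bodyD(2)[OF x] by simp
  qed
  moreover have "excess (z e) \<le> 1"
  proof (cases "excess x = 1")
    case True
    \<comment> \<open>From \<open>y\<close> through \<open>x\<close> to \<open>z e\<close> no
      coordinate crosses 1: if \<open>x $ i\<close> is not 1, the choice of \<open>e\<close> keeps
      its side, and if it is 1, then \<open>y $ i = 1\<close> makes the coordinate constant. So the
      overshoot is affine there.\<close>
    have "max 0 (z e $ i - 1) = (1 + e) * max 0 (x $ i - 1) - e * max 0 (y $ i - 1)" for i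
    proof -
      consider "x $ i < 1" | "x $ i = 1" | "1 < x $ i" by linarith
      then show ?thesis
      proof cases
        case 1
        then have "y $ i \<le> 1" using yx True by (simp add: tight_below_def)
        with 1 ei(2)[of i] show ?thesis by simp
      next
        case 2
        then have "y $ i = 1" using yx True by (simp add: tight_below_def order_antisym)
        with 2 show ?thesis by (simp add: z_def)
      next
        case 3
        then have "1 \<le> y $ i" using yx True by (simp add: tight_below_def)
        with 3 ei(3)[of i] show ?thesis by (simp add: z_def algebra_simps)
      qed
    qed
    then have "excess (z e) = (1 + e) * excess x - e * excess y"
      by (simp add: excess_def sum_subtractf sum_distrib_left)
    then show ?thesis using yx True by (simp add: tight_below_def)
  next
    case False
    then show ?thesis using ee sum_bodyD(3)[OF x] by simp
  qed
  ultimately have "z e \<in> sum_body" by (simp add: sum_body_def)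
  with e show ?thesis unfolding z_def by blast
qed

section \<open>The marked tubing of a point\<close>

definition node_marking :: "bool \<Rightarrow> real \<Rightarrow> marking option" where
  "node_marking thick r =
    (if r = 0 then Some Thin else if \<not> thick then None
     else if r < 1 then Some Broken else if r = 1 then Some Thick else None)"

text \<open>The test for \<open>range g\<close> comes first, so that the singleton of a one-node
  graph is treated as the universal tube. For the other singletons \<open>inv g\<close> recovers the
  coordinate.\<close>

definition marking_of :: "('n \<Rightarrow> 'v) \<Rightarrow> real ^ 'n \<Rightarrow> 'v set \<rightharpoonup> marking" where
  "marking_of g x w =
    (if w = range g
     then Some (if coord_sum x = 1 then Thin else if excess x = 1 then Thick else Broken)
     else if \<exists>i. w = {g i} then node_marking (excess x = 1) (x $ inv g (the_elem w))
     else None)"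

lemma marking_of_universal:
  "marking_of g x (range g) =
    Some (if coord_sum x = 1 then Thin else if excess x = 1 then Thick else Broken)"
  by (simp add: marking_of_def)

lemma marking_of_node:
  "inj g \<Longrightarrow> {g i} \<noteq> range g \<Longrightarrow> marking_of g x {g i} = node_marking (excess x = 1) (x $ i)"
  by (auto simp: marking_of_def)

lemma marking_of_other: "w \<noteq> range g \<Longrightarrow> (\<And>i. w \<noteq> {g i}) \<Longrightarrow> marking_of g x w = None"
  by (simp add: marking_of_def)

lemma node_marking_Thin: "node_marking t r = Some Thin \<longleftrightarrow> r = 0"
  by (simp add: node_marking_def)

lemma node_marking_below:
  assumes "0 \<le> r" "0 \<le> s"
  shows "node_below (node_marking True s) (node_marking True r) \<longleftrightarrow>
    (r = 0 \<longrightarrow> s = 0) \<and> (r \<le> 1 \<longrightarrow> s \<le> 1) \<and> (1 \<le> r \<longrightarrow> 1 \<le> s)"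
  using assms by (simp add: node_below_def node_marking_def)

lemma excess_one_coord:
  assumes "excess x = 1"
  obtains i where "1 < x $ i"
proof -
  have "\<exists>i. 1 < x $ i"
  proof (rule ccontr)
    assume "\<not> (\<exists>i. 1 < x $ i)"
    then have "max 0 (x $ i - 1) = 0" for i by (simp add: not_less)
    then have "excess x = 0" by (simp add: excess_def)
    with assms show False by simp
  qed
  then show thesis using that by blast
qed

text \<open>Shows that the conditions for a thin and for a thick universal tube exclude each other,
  so the order of the two tests in \<open>marking_of\<close> is immaterial on
  \<open>sum_body\<close>.\<close>

lemma excess_one_coord_sum:
  assumes "excess x = 1" "\<And>i. 0 \<le> x $ i"
  shows "1 < coord_sum x"
proof -
  obtain i where "1 < x $ i" using excess_one_coord[OF assms(1)] .
  also have "x $ i \<le> coord_sum x"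
    unfolding coord_sum_def by (rule member_le_sum) (use assms(2) in simp_all)
  finally show ?thesis .
qed

text \<open>When there is a single node, its singleton is the universal tube and its coordinate is
  not recorded by a node marking.\<close>

lemma single_node_coord:
  assumes g: "inj g" and i: "{g i} = range g" and x: "x \<in> sum_body"
  shows "1 \<le> x $ i" "excess x = 1 \<Longrightarrow> 1 < x $ i"
proof -
  have U: "j = i" for j
  proof -
    have "g j \<in> {g i}" unfolding i by (rule rangeI)
    then show ?thesis using g by (simp add: inj_eq)
  qed
  have UNIV: "UNIV = {i}" using U by blast
  have "coord_sum x = x $ i" by (simp add: coord_sum_def UNIV)
  then show "1 \<le> x $ i" using sum_bodyD(2)[OF x] by simp
  show "1 < x $ i" if "excess x = 1" using excess_one_coord[OF that] U by metis
qed

text \<open>Thin tubes record the tight conditions \<open>x $ i = 0\<close> and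
  \<open>coord_sum x = 1\<close>, a thick universal tube records \<open>excess x = 1\<close>. The
  position of a coordinate relative to 1 is visible only below a thick universal tube, which is
  exactly when \<open>tight_below\<close> refers to it.\<close>

lemma marking_of_below_iff:
  assumes g: "inj g" and x: "x \<in> sum_body" and y: "y \<in> sum_body"
  shows "marking_below (range g) (marking_of g y) (marking_of g x) \<longleftrightarrow> tight_below y x"
proof
  assume below: "marking_below (range g) (marking_of g y) (marking_of g x)"
  have univ: "marking_of g y (range g) = marking_of g x (range g) \<or>
      marking_of g x (range g) = Some Broken"
    by (rule marking_below_universal[OF below])
  show "tight_below y x"
    unfolding tight_below_def
  proof (intro conjI impI allI)
    show "coord_sum y = 1" if "coord_sum x = 1"
      using univ that by (simp add: marking_of_universal split: if_splits)
    show y0: "y $ i = 0" if "x $ i = 0" for i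
    proof (cases "{g i} = range g")
      case True
      then show ?thesis using single_node_coord(1)[OF g True x] that by simp
    next
      case False
      have "marking_of g x {g i} = Some Thin"
        using that by (simp add: marking_of_node[OF g False] node_marking_Thin)
      then have "marking_of g y {g i} = Some Thin"
        using marking_below_thick[OF below _ False] marking_below_thin[OF below _ False]
        by (cases "marking_of g x (range g) = Some Thick") (simp_all add: node_below_Thin)
      then show ?thesis by (simp add: marking_of_node[OF g False] node_marking_Thin)
    qed
    show ey: "excess y = 1" if ex: "excess x = 1"
      using univ excess_one_coord_sum[OF ex sum_bodyD(1)[OF x]] ex
      by (simp add: marking_of_universal split: if_splits)
    have sides: "(x $ i \<le> 1 \<longrightarrow> y $ i \<le> 1) \<and> (1 \<le> x $ i \<longrightarrow> 1 \<le> y $ i)"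
      if ex: "excess x = 1" for i
    proof (cases "{g i} = range g")
      case True
      then show ?thesis
        using single_node_coord[OF g True x] single_node_coord[OF g True y] ex by simp
    next
      case False
      have "marking_of g x (range g) = Some Thick"
        using excess_one_coord_sum[OF ex sum_bodyD(1)[OF x]] ex by (simp add: marking_of_universal)
      then have "node_below (marking_of g y {g i}) (marking_of g x {g i})"
        by (rule marking_below_thick[OF below _ False])
      then show ?thesis
        using node_marking_below[OF sum_bodyD(1)[OF x] sum_bodyD(1)[OF y]] ex ey[OF ex]
        by (simp add: marking_of_node[OF g False])
    qed
    show "y $ i \<le> 1" if "excess x = 1" "x $ i \<le> 1" for i using sides that by blast
    show "1 \<le> y $ i" if "excess x = 1" "1 \<le> x $ i" for i using sides that by blast
  qed
next
  assume tight: "tight_below y x"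
  have ey: "excess y = 1" if "excess x = 1" using tight that by (simp add: tight_below_def)
  show "marking_below (range g) (marking_of g y) (marking_of g x)"
  proof (rule marking_belowI)
    \<comment> \<open>If \<open>x\<close> gives thin, so does \<open>y\<close>. If \<open>x\<close>
      gives thick, then \<open>excess y = 1\<close>, and this rules out
      \<open>coord_sum y = 1\<close>, so \<open>y\<close> gives thick as well.\<close>
    show "marking_of g y (range g) = marking_of g x (range g) \<or>
        marking_of g x (range g) = Some Broken"
      using tight excess_one_coord_sum[OF _ sum_bodyD(1)[OF y]]
      by (auto simp: marking_of_universal tight_below_def)
  next
    fix w assume w: "w \<noteq> range g" and thick: "marking_of g x (range g) = Some Thick"
    then have ex: "excess x = 1" by (simp add: marking_of_universal split: if_splits)
    show "node_below (marking_of g y w) (marking_of g x w)"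
    proof (cases "\<exists>i. w = {g i}")
      case True
      then obtain i where i: "w = {g i}" by blast
      then have "{g i} \<noteq> range g" using w by simp
      then show ?thesis
        unfolding i using tight ex ey node_marking_below[OF sum_bodyD(1)[OF x] sum_bodyD(1)[OF y]]
        by (simp add: marking_of_node[OF g] tight_below_def)
    next
      case False
      then show ?thesis using w by (simp add: marking_of_other node_below_def)
    qed
  next
    fix w assume w: "w \<noteq> range g" and thin: "marking_of g x w = Some Thin"
    have "\<exists>i. w = {g i}"
      using marking_of_other[OF w, of x] thin by (metis option.distinct(1))
    then obtain i where i: "w = {g i}" by blast
    then have "{g i} \<noteq> range g" using w by simp
    then show "marking_of g y w = Some Thin"
      using thin tight unfolding i
      by (simp add: marking_of_node[OF g] node_marking_Thin tight_below_def)
  qed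
qed

lemma marked_tubing_marking_of:
  assumes g: "inj g" and x: "x \<in> sum_body"
  shows "marked_tubing (range g) {} (marking_of g x)"
  unfolding marked_tubing_edgeless
proof (intro conjI impI allI)
  show "range g \<in> dom (marking_of g x)" by (simp add: domIff marking_of_universal)
  show "dom (marking_of g x) \<subseteq> insert (range g) ((\<lambda>v. {v}) ` range g)"
  proof
    fix w assume "w \<in> dom (marking_of g x)"
    then have "w = range g \<or> (\<exists>i. w = {g i})"
      using marking_of_other[of w g x] by (metis domIff)
    then show "w \<in> insert (range g) ((\<lambda>v. {v}) ` range g)" by blast
  qed
  \<comment> \<open>The node that the tubing leaves out: a coordinate above 1 in the thick case,
    otherwise any nonzero coordinate, which exists because the coordinates sum to at least
    1.\<close>
  have "\<exists>i. node_marking (excess x = 1) (x $ i) = None"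
  proof (cases "excess x = 1")
    case True
    then show ?thesis using excess_one_coord[OF True]
      by (metis less_irrefl less_trans node_marking_def zero_less_one)
  next
    case False
    have "\<exists>i. x $ i \<noteq> 0"
    proof (rule ccontr)
      assume "\<not> (\<exists>i. x $ i \<noteq> 0)"
      then have "coord_sum x = 0" by (simp add: coord_sum_def)
      then show False using sum_bodyD(2)[OF x] by simp
    qed
    then show ?thesis using False by (simp add: node_marking_def)
  qed
  then obtain i where i: "node_marking (excess x = 1) (x $ i) = None" by blast
  then have "range g = {g i} \<or> {g i} \<notin> dom (marking_of g x)"
    using marking_of_node[OF g, of i x] by (metis domIff)
  then show "\<exists>v\<in>range g. range g = {v} \<or> {v} \<notin> dom (marking_of g x)" by blast
  fix w assume nthick: "marking_of g x (range g) \<noteq> Some Thick" and w: "w \<noteq> range g"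
  have "excess x \<noteq> 1"
  proof
    assume "excess x = 1"
    then show False
      using nthick excess_one_coord_sum[OF _ sum_bodyD(1)[OF x]] by (simp add: marking_of_universal)
  qed
  then have None_or_Thin: "node_marking (excess x = 1) s = None \<or>
      node_marking (excess x = 1) s = Some Thin" for s
    by (simp add: node_marking_def)
  show "marking_of g x w = None \<or> marking_of g x w = Some Thin"
  proof (cases "\<exists>i. w = {g i}")
    case True
    then obtain i where "w = {g i}" by blast
    then show ?thesis using marking_of_node[OF g, of i x] w None_or_Thin by simp
  next
    case False
    then show ?thesis using marking_of_other[OF w] by simp
  qed
qed

lemma marking_of_surj:
  fixes g :: "'n::finite \<Rightarrow> 'v"
  assumes g: "inj g" and M: "marked_tubing (range g) {} M"
  obtains x where "x \<in> sum_body" "marking_of g x = M"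
proof -
  \<comment> \<open>The coordinates not prescribed by a node marking, including the only one of a
    one-node graph. All of them get the same value \<open>r\<close>; \<open>U\<close> is nonempty by
    the properness condition on tubings.\<close>
  define U where "U = {i. {g i} = range g \<or> M {g i} = None}"
  define k where "k = real (card U)"
  \<comment> \<open>\<open>1 / k\<close> makes the coordinate sum 1 and \<open>1 + 1 / k\<close>
    makes the excess 1. With \<open>3 / (2 * k)\<close> neither is tight: the sum is 3/2, and the
    excess is 1/2 for \<open>k = 1\<close> and 0 for larger \<open>k\<close>.\<close>
  define r where "r = (case M (range g) of Some Thin \<Rightarrow> 1 / k | Some Broken \<Rightarrow> 3 / (2 * k)
    | _ \<Rightarrow> 1 + 1 / k)"
  define x :: "real ^ 'n" where "x = (\<chi> i. if i \<in> U then r else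
    (case M {g i} of Some Broken \<Rightarrow> 1 / 2 | Some Thick \<Rightarrow> 1 | _ \<Rightarrow> 0))"
  have "\<exists>v\<in>range g. range g = {v} \<or> {v} \<notin> dom M"
    using M unfolding marked_tubing_edgeless by blast
  then obtain i where "range g = {g i} \<or> {g i} \<notin> dom M" by blast
  then have "i \<in> U" by (auto simp: U_def)
  then have "0 < card U" by (simp add: card_gt_0_iff) blast
  then have k: "1 \<le> k" by (simp add: k_def Suc_le_eq)
  have MV: "M (range g) = Some Thin \<or> M (range g) = Some Broken \<or> M (range g) = Some Thick"
  proof -
    obtain m where "M (range g) = Some m" using marked_tubing_edgeless_universal[OF M] by blast
    then show ?thesis by (cases m) simp_all
  qed
  have "0 < 1 / k" using k by simp
  then have "0 < 1 + 1 / k" by linarith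
  then have r: "0 < r" using k MV by (elim disjE) (simp_all add: r_def del: zero_less_divide_1_iff)
  have x0: "0 \<le> x $ i" for i using r by (simp add: x_def split: option.split marking.split)
  have sum_U: "(\<Sum>i\<in>UNIV. if i \<in> U then c else 0) = k * c" for c :: real
    by (simp add: sum.If_cases k_def)
  have excess: "excess x = k * max 0 (r - 1)"
  proof -
    have "max 0 (x $ i - 1) = (if i \<in> U then max 0 (r - 1) else 0)" for i
      by (simp add: x_def split: option.split marking.split)
    then show ?thesis by (simp add: excess_def sum_U)
  qed
  \<comment> \<open>Below a universal tube that is not thick all nodes outside \<open>U\<close> are
    thin and contribute 0.\<close>
  have thin: "coord_sum x = k * r" if "M (range g) \<noteq> Some Thick"
  proof -
    have "x $ i = (if i \<in> U then r else 0)" for i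
    proof (cases "i \<in> U")
      case False
      then have "{g i} \<noteq> range g" "M {g i} \<noteq> None" by (simp_all add: U_def)
      then have "M {g i} = Some Thin" using marked_tubing_edgeless_thin[OF M that] by metis
      then show ?thesis using False by (simp add: x_def)
    qed (simp add: x_def)
    then show ?thesis by (simp add: coord_sum_def sum_U)
  qed
  have univ: "x \<in> sum_body \<and> marking_of g x (range g) = M (range g) \<and>
      (excess x = 1 \<longleftrightarrow> M (range g) = Some Thick)"
    using MV
  proof (elim disjE)
    assume V: "M (range g) = Some Thin"
    then have "r = 1 / k" by (simp add: r_def)
    then have "coord_sum x = 1" "excess x = 0" using thin excess V k by simp_all
    then show ?thesis using V x0 by (simp add: sum_body_def marking_of_universal)
  next
    assume V: "M (range g) = Some Broken"
    then have r: "r = 3 / (2 * k)" by (simp add: r_def)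
    then have "coord_sum x = 3 / 2" using thin V k by simp
    moreover have "excess x < 1"
    proof -
      have "excess x = max 0 (k * (r - 1))" using excess k by (simp add: max_mult_distrib_left)
      also have "k * (r - 1) = 3 / 2 - k" using r k by (simp add: field_simps)
      finally show ?thesis using k by simp
    qed
    ultimately show ?thesis using V x0 by (simp add: sum_body_def marking_of_universal)
  next
    assume V: "M (range g) = Some Thick"
    then have "r = 1 + 1 / k" by (simp add: r_def)
    then have e: "excess x = 1" using excess k by simp
    then show ?thesis using V x0 excess_one_coord_sum[OF e x0]
      by (simp add: sum_body_def marking_of_universal)
  qed
  moreover have "marking_of g x w = M w" for w
  proof (cases "w = range g")
    case w: False
    show ?thesis
    proof (cases "\<exists>i. w = {g i}")
      case True
      then obtain i where i: "w = {g i}" by blast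
      have "node_marking (M (range g) = Some Thick) (x $ i) = M {g i}"
      proof (cases "i \<in> U")
        case True
        then have "M {g i} = None" "x $ i = r" using w i by (simp_all add: U_def x_def)
        moreover have "1 < r" if "M (range g) = Some Thick" using that k by (simp add: r_def)
        ultimately show ?thesis using r by (auto simp: node_marking_def)
      next
        case False
        then have "M {g i} \<noteq> None" by (simp add: U_def)
        then obtain m where m: "M {g i} = Some m" by auto
        moreover have "m = Thin" if "M (range g) \<noteq> Some Thick"
          using marked_tubing_edgeless_thin[OF M that, of "{g i}"] w i m by simp
        ultimately show ?thesis using False
          by (cases m) (auto simp: node_marking_def x_def)
      qed
      then show ?thesis using univ marking_of_node[OF g, of i x] w i by simp
    next
      case False
      then have "w \<notin> dom M" using marked_tubing_edgeless_tube[OF M, of w] w by blast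
      then have "M w = None" by (simp add: domIff)
      then show ?thesis using False w by (simp add: marking_of_other)
    qed
  qed (use univ in simp)
  ultimately show thesis using that[of x] by blast
qed

section \<open>The face poset of the sum and the multiplihedron\<close>

lemma sum_body_faces:
  fixes V :: "'v set"
  assumes "finite V" and "card V = CARD('n::finite)"
  shows "posets_isomorphic (nonempty_faces (sum_body :: (real ^ 'n) set)) (\<subseteq>)
    {M. marked_tubing V {} M} (marking_le V {})"
proof -
  obtain g :: "'n \<Rightarrow> 'v" where "bij_betw g UNIV V"
    using finite_same_card_bij[of "UNIV :: 'n set" V] assms by auto
  then have g: "inj g" and V: "V = range g" by (auto simp: bij_betw_def)
  let ?t = "marking_of g :: real ^ 'n \<Rightarrow> _"
  have le: "marking_le V {} M N \<longleftrightarrow> marking_below V M N"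
    if "M \<in> {M. marked_tubing V {} M}" "N \<in> {M. marked_tubing V {} M}" for M N
    using marking_le_iff_below[OF assms(1)] that by simp
  have mt: "?t x \<in> {M. marked_tubing V {} M}" if "x \<in> sum_body" for x
    using marked_tubing_marking_of[OF g that] by (simp add: V)
  have le_t: "marking_le V {} (?t y) (?t x) \<longleftrightarrow> tight_below y x"
    if "x \<in> sum_body" "y \<in> sum_body" for x y
    using le[OF mt[OF that(2)] mt[OF that(1)]] marking_of_below_iff[OF g that] by (simp add: V)
  show ?thesis
  proof (rule nonempty_faces_isomorphic_types[where t = ?t])
    show "?t ` sum_body = {M. marked_tubing V {} M}"
    proof
      show "?t ` sum_body \<subseteq> {M. marked_tubing V {} M}" using mt by blast
      show "{M. marked_tubing V {} M} \<subseteq> ?t ` sum_body"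
      proof
        fix M assume "M \<in> {M. marked_tubing V {} M}"
        then have "marked_tubing (range g) {} M" by (simp add: V)
        from marking_of_surj[OF g this] show "M \<in> ?t ` sum_body" by blast
      qed
    qed
    show "marking_le V {} M M" for M by (simp add: marking_le_def)
    show "marking_le V {} L N" if "marking_le V {} L M" "marking_le V {} M N" for L M N
      using that unfolding marking_le_def by (rule rtranclp_trans[rotated])
    show "M = N" if "M \<in> {M. marked_tubing V {} M}" "N \<in> {M. marked_tubing V {} M}"
      "marking_le V {} M N" "marking_le V {} N M" for M N
      using that le[OF that(1,2)] le[OF that(2,1)] marking_below_antisym by simp
    show "{y \<in> sum_body. marking_le V {} (?t y) (?t x)} face_of sum_body" if "x \<in> sum_body" for x
    proof -
      have "{y \<in> sum_body. marking_le V {} (?t y) (?t x)} = {y \<in> sum_body. tight_below y x}"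
        using le_t[OF that] by blast
      then show ?thesis by (simp add: tight_below_face_of)
    qed
    show "\<exists>e>0. x + e *\<^sub>R (x - y) \<in> sum_body"
      if "x \<in> sum_body" "y \<in> sum_body" "marking_le V {} (?t y) (?t x)" for x y
      using tight_below_prolong[OF that(1,2)] le_t[OF that(1,2)] that(3) by simp
  qed
qed

theorem proposition11:
  fixes V :: "'v set"
  assumes "finite V" and "card V = CARD('n::finite)"
  shows "(\<exists>P :: (real ^ 'n) set. graph_multiplihedron V {} P) \<and>
    (\<forall>P :: 'a::euclidean_space set. graph_multiplihedron V {} P \<longrightarrow>
      combinatorially_equivalent P
        ((cube_simplex :: (real ^ 'n) set) + cube_minus_simplex))"
proof (intro conjI allI impI)
  note iso = sum_body_faces[OF assms]
  have "V \<noteq> {}" using assms(2) by auto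
  then have "simple_graph V {}"
    using assms(1) by (simp add: simple_graph_def irrefl_def)
  \<comment> \<open>The sum itself is a realization. Any other one has the same face poset up to
    isomorphism, through the common poset of marked tubings.\<close>
  then have "graph_multiplihedron V {} (sum_body :: (real ^ 'n) set)"
    using iso assms(2)
    by (simp add: graph_multiplihedron_def polytope_sum_body aff_dim_sum_body)
  then show "\<exists>P :: (real ^ 'n) set. graph_multiplihedron V {} P" by blast
  fix P :: "'a set" assume "graph_multiplihedron V {} P"
  then have "polytope P" and "posets_isomorphic (nonempty_faces P) (\<subseteq>)
      {M. marked_tubing V {} M} (marking_le V {})"
    by (simp_all add: graph_multiplihedron_def)
  then show "combinatorially_equivalent P
      ((cube_simplex :: (real ^ 'n) set) + cube_minus_simplex)"
    using posets_isomorphic_trans[OF _ posets_isomorphic_sym[OF iso]]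
    by (simp add: combinatorially_equivalent_def cube_simplex_plus_cube_minus_simplex
        polytope_sum_body)
qed

end
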